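(* Let $n\ge1$ and let $a,b,c\ge0$ be integers with $a+b+\binom{c+1}{2} \leq \binom{n}{2}$. Then there is at least one valley-marked parking function $MPF$ of size $n$ with $\operatorname{area}(MPF)=a$, $\operatorname{dinv}(MPF)=b$, and exactly $c$ marked valleys.
   Context: A Dyck path of size $n$ goes from $(0,0)$ to $(n,n)$ with unit North/East steps weakly above $y=x$; a parking function of size $n$ is such a path with $n$ distinct positive integer cars placed one in the cell immediately right of each North step, increasing upward in each column. The cell with lower-left corner $(i,j)$ lies in the $(j-i)$-diagonal; left/right for cars refers to columns. $\operatorname{area}$ is the number of full cells between the path and $y=x$. A valley is an East step immediately followed by a North step such that the cell directly below the East step has no car or has a car smaller than the car next to that North step. A valley-marked parking function is a parking function with a subset of its valleys marked; the car next to a marked valley's North step is marked. For cars $s<b$: a primary diagonal inversion occurs if $s,b$ are in the same diagonal, $s$ is to the left of $b$, and $s$ is unmarked; a secondary diagonal inversion occurs if $b$ is in the diagonal one above $s$'s, $b$ is to the left of $s$, and $b$ is unmarked. $\operatorname{dinv}$ is the number of primary and secondary diagonal inversions minus the number of marked valleys. *)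

theory Defs
  imports Complex_Main
begin

datatype step = North | East

type_synonym path = "step list"

text \<open>A cell is named by its lower-left corner.\<close>

type_synonym cell = "int \<times> int"

definition point :: "path \<Rightarrow> nat \<Rightarrow> int \<times> int" where
  "point p k = (int (count_list (take k p) East), int (count_list (take k p) North))"

definition dyck_path :: "nat \<Rightarrow> path \<Rightarrow> bool" where
  "dyck_path n p \<longleftrightarrow>
     point p (length p) = (int n, int n) \<and>
     (\<forall>k\<le>length p. fst (point p k) \<le> snd (point p k))"

text \<open>The cell immediately right of a North step has the starting point of that step as its
  lower-left corner.\<close>

definition north_cells :: "path \<Rightarrow> cell set" where
  "north_cells p = {point p k |k. k < length p \<and> p ! k = North}"

definition parking_function :: "nat \<Rightarrow> path \<Rightarrow> (cell \<rightharpoonup> nat) \<Rightarrow> bool" where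
  "parking_function n p car \<longleftrightarrow>
     dyck_path n p \<and>
     dom car = north_cells p \<and>
     inj_on car (dom car) \<and>
     (\<forall>r\<in>ran car. 0 < r) \<and>
     (\<forall>i j j' r r'. car (i, j) = Some r \<longrightarrow> car (i, j') = Some r' \<longrightarrow> j < j' \<longrightarrow> r < r')"

text \<open>A valley is named by the index of its East step; the car next to its North step sits in
  the cell \<open>point p (Suc k)\<close>.\<close>

definition valley :: "path \<Rightarrow> (cell \<rightharpoonup> nat) \<Rightarrow> nat \<Rightarrow> bool" where
  "valley p car k \<longleftrightarrow>
     Suc k < length p \<and> p ! k = East \<and> p ! Suc k = North \<and>
     (let (i, j) = point p k in
        car (i, j - 1) = None \<or> the (car (i, j - 1)) < the (car (point p (Suc k))))"

definition valley_marked_parking_function ::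
    "nat \<Rightarrow> path \<Rightarrow> (cell \<rightharpoonup> nat) \<Rightarrow> nat set \<Rightarrow> bool" where
  "valley_marked_parking_function n p car M \<longleftrightarrow>
     parking_function n p car \<and> M \<subseteq> {k. valley p car k}"

definition marked_cells :: "path \<Rightarrow> nat set \<Rightarrow> cell set" where
  "marked_cells p M = (\<lambda>k. point p (Suc k)) ` M"

text \<open>The cell \<open>(i, j)\<close> lies weakly above \<open>y = x\<close> iff \<open>i + 1 \<le> j\<close>, and below the path iff the
  North step in row \<open>j\<close> starts at some \<open>(x, j)\<close> with \<open>x \<le> i\<close>.\<close>

definition area :: "path \<Rightarrow> nat" where
  "area p = card {(i, j). i + 1 \<le> j \<and> (\<exists>x\<le>i. (x, j) \<in> north_cells p)}"

definition diagonal :: "cell \<Rightarrow> int" where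
  "diagonal u = snd u - fst u"

text \<open>In both sets of inversions, \<open>u\<close> is the cell of the smaller car \<open>s\<close> and \<open>v\<close> the cell of the
  bigger car \<open>b\<close>.\<close>

definition primary_inversions :: "path \<Rightarrow> (cell \<rightharpoonup> nat) \<Rightarrow> nat set \<Rightarrow> (cell \<times> cell) set" where
  "primary_inversions p car M =
     {(u, v). \<exists>s b. car u = Some s \<and> car v = Some b \<and> s < b \<and>
        diagonal u = diagonal v \<and> fst u < fst v \<and> u \<notin> marked_cells p M}"

definition secondary_inversions :: "path \<Rightarrow> (cell \<rightharpoonup> nat) \<Rightarrow> nat set \<Rightarrow> (cell \<times> cell) set" where
  "secondary_inversions p car M =
     {(u, v). \<exists>s b. car u = Some s \<and> car v = Some b \<and> s < b \<and>
        diagonal v = diagonal u + 1 \<and> fst v < fst u \<and> v \<notin> marked_cells p M}"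

definition dinv :: "path \<Rightarrow> (cell \<rightharpoonup> nat) \<Rightarrow> nat set \<Rightarrow> int" where
  "dinv p car M =
     int (card (primary_inversions p car M)) + int (card (secondary_inversions p car M))
       - int (card M)"

end

theory Submission
  imports Defs
begin

text \<open>A parking function is encoded by the diagonals and labels of its rows. Induct on \<open>n\<close>.
  If \<open>a \<ge> n - 1\<close>, move everything one diagonal up and put a smallest car at the bottom: this adds
  \<open>n - 1\<close> to the area and does not change the dinv. If the bound already holds for \<open>n - 1\<close>, put a
  largest car at the bottom of the main diagonal: this changes neither statistic. Otherwise
  \<open>b\<close> misses the maximum \<open>(n choose 2) - (c + 1 choose 2) - a\<close> by less than \<open>n - 1\<close>. The maximum
  is attained by the diagonals \<open>0 1\<^sup>a 0\<^sup>r\<close> with the top \<open>c\<close> rows marked and labels making every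
  possible pair an inversion; changing the labels of the two bottom rows removes any
  prescribed number of at most \<open>n - 2\<close> inversions.\<close>

section \<open>Labelled area words\<close>

lemma count_list_map_upt: "count_list (map f [0..<k]) y = card {i \<in> {..<k}. f i = y}"
proof (induction k)
  case (Suc k)
  have "{i \<in> {..<Suc k}. f i = y} =
      (if f k = y then insert k {i \<in> {..<k}. f i = y} else {i \<in> {..<k}. f i = y})"
    by (auto simp: less_Suc_eq)
  then show ?case using Suc by simp
qed simp

text \<open>Row \<open>i\<close>, counted from the bottom, has its car \<open>l i\<close> in the
  \<open>d i\<close>-diagonal, and \<open>m\<close> collects the marked rows. The two cases of
  \<open>m_valley\<close> are those of the cell below the East step preceding row
  \<open>Suc i\<close>: it is empty if \<open>d (Suc i) < d i\<close> and holds the car of row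
  \<open>i\<close> if \<open>d (Suc i) = d i\<close>.\<close>

locale labelled_area_word =
  fixes n :: nat and d l :: "nat \<Rightarrow> nat" and m :: "nat set"
  assumes d_0: "d 0 = 0"
    and d_Suc: "Suc i < n \<Longrightarrow> d (Suc i) \<le> Suc (d i)"
    and l_inj: "inj_on l {..<n}"
    and l_pos: "i < n \<Longrightarrow> 0 < l i"
    and l_Suc: "Suc i < n \<Longrightarrow> d (Suc i) = Suc (d i) \<Longrightarrow> l i < l (Suc i)"
    and m_sub: "m \<subseteq> {1..<n}"
    and m_valley: "Suc i \<in> m \<Longrightarrow> d (Suc i) < d i \<or> d (Suc i) = d i \<and> l i < l (Suc i)"

text \<open>For \<open>i < j\<close> the first case is a primary inversion with the smaller car in
  row \<open>i\<close>, the second a secondary one with the bigger car in row \<open>i\<close>.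
  Either way the lower row \<open>i\<close> is the one that has to be unmarked.\<close>

definition word_inv :: "(nat \<Rightarrow> nat) \<Rightarrow> (nat \<Rightarrow> nat) \<Rightarrow> nat \<Rightarrow> nat \<Rightarrow> bool" where
  "word_inv d l i j \<longleftrightarrow> d i = d j \<and> l i < l j \<or> d i = Suc (d j) \<and> l j < l i"

text \<open>Each inversion is charged to its lower row. A marked row therefore has no inversions to
  count and contributes only the -1 of its mark.\<close>

definition word_dinv :: "nat \<Rightarrow> (nat \<Rightarrow> nat) \<Rightarrow> (nat \<Rightarrow> nat) \<Rightarrow> nat set \<Rightarrow> int" where
  "word_dinv n d l m =
     (\<Sum>i<n. if i \<in> m then -1 else int (card {j \<in> {i<..<n}. word_inv d l i j}))"

context labelled_area_word
begin

lemma d_le: "i < n \<Longrightarrow> d i \<le> i"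
proof (induction i)
  case (Suc i)
  then show ?case using d_Suc[of i] by simp
qed (simp add: d_0)

section \<open>The Dyck path of an area word\<close>

definition col :: "nat \<Rightarrow> nat" where
  "col j = j - d j"

text \<open>The index in the path of the North step of row \<open>j\<close>, which follows
  \<open>col j\<close> East steps and \<open>j\<close> North steps.\<close>

definition pos :: "nat \<Rightarrow> nat" where
  "pos j = col j + j"

definition word_path :: path where
  "word_path = map (\<lambda>k. if k \<in> pos ` {..<n} then North else East) [0..<2 * n]"

definition word_car :: "cell \<rightharpoonup> nat" where
  "word_car u = (if \<exists>j<n. u = (int (col j), int j) then Some (l (nat (snd u))) else None)"

definition word_marks :: "nat set" where
  "word_marks = (\<lambda>j. pos j - 1) ` m"

abbreviation cell_of :: "nat \<Rightarrow> cell" where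
  "cell_of j \<equiv> (int (col j), int j)"

lemma col_le: "col j \<le> j"
  by (simp add: col_def)

lemma int_col: "j < n \<Longrightarrow> int (col j) = int j - int (d j)"
  using d_le[of j] by (simp add: col_def)

lemma col_mono: "i \<le> j \<Longrightarrow> j < n \<Longrightarrow> col i \<le> col j"
proof (induction j rule: dec_induct)
  case (step j)
  then have "col i \<le> col j" by simp
  also have "col j \<le> col (Suc j)"
    using d_Suc[of j] step.prems d_le[of j] by (simp add: col_def)
  finally show ?case .
qed simp

lemma pos_less: "i < j \<Longrightarrow> j < n \<Longrightarrow> pos i < pos j"
  using col_mono[of i j] by (simp add: pos_def)

lemma pos_less_iff: "i < n \<Longrightarrow> j < n \<Longrightarrow> pos i < pos j \<longleftrightarrow> i < j"
  using pos_less[of i j] pos_less[of j i] by (metis less_asym linorder_neqE_nat)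

lemma pos_inj: "inj_on pos {..<n}"
  by (rule inj_onI) (metis lessThan_iff less_irrefl linorder_neqE_nat pos_less)

lemma pos_bound: "j < n \<Longrightarrow> Suc (pos j) < 2 * n"
  using col_le[of j] by (simp add: pos_def)

definition norths :: "nat \<Rightarrow> nat" where
  "norths k = card {j \<in> {..<n}. pos j < k}"

lemma length_word_path [simp]: "length word_path = 2 * n"
  by (simp add: word_path_def)

lemma nth_word_path:
  "k < 2 * n \<Longrightarrow> word_path ! k = (if k \<in> pos ` {..<n} then North else East)"
  by (simp add: word_path_def)

lemma point_word_path:
  assumes "k \<le> 2 * n"
  shows "point word_path k = (int k - int (norths k), int (norths k))"
proof -
  let ?f = "\<lambda>k. if k \<in> pos ` {..<n} then North else East"
  let ?N = "{i \<in> {..<k}. ?f i = North}" and ?E = "{i \<in> {..<k}. ?f i = East}"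
  have t: "take k word_path = map ?f [0..<k]"
    using assms by (simp add: word_path_def take_map)
  have "?N = pos ` {j \<in> {..<n}. pos j < k}"
    by (auto split: if_splits)
  then have N: "card ?N = norths k"
    using card_image[OF inj_on_subset[OF pos_inj, of "{j \<in> {..<n}. pos j < k}"]]
    by (auto simp: norths_def)
  have "card (?N \<union> ?E) = card ?N + card ?E"
    by (rule card_Un_disjoint) auto
  moreover have "?N \<union> ?E = {..<k}" by auto
  ultimately have "card ?N + card ?E = k" by simp
  then have "int (card ?E) = int k - int (norths k)" using N by linarith
  then show ?thesis using N
    unfolding point_def t count_list_map_upt by simp
qed

lemma norths_eqI:
  assumes "j \<le> n" "\<And>i. i < j \<Longrightarrow> pos i < k" "\<And>i. j \<le> i \<Longrightarrow> i < n \<Longrightarrow> k \<le> pos i"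
  shows "norths k = j"
proof -
  have "{i \<in> {..<n}. pos i < k} = {..<j}"
    using assms by (force simp: not_le[symmetric])
  then show ?thesis by (simp add: norths_def)
qed

lemma point_pos:
  assumes "j < n"
  shows "point word_path (pos j) = cell_of j"
proof -
  have "norths (pos j) = j"
    using assms pos_less_iff by (intro norths_eqI) (auto simp: not_less[symmetric])
  then show ?thesis
    using assms point_word_path[of "pos j"] pos_bound[of j] by (simp add: pos_def)
qed

lemma north_cells_word_path: "north_cells word_path = cell_of ` {..<n}"
proof (intro equalityI subsetI)
  fix u assume "u \<in> north_cells word_path"
  then obtain k where k: "u = point word_path k" "k < 2 * n" "word_path ! k = North"
    by (auto simp: north_cells_def)
  then obtain j where "j < n" "k = pos j"
    by (auto simp: nth_word_path split: if_splits)
  then show "u \<in> cell_of ` {..<n}" using k point_pos by auto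
next
  fix u assume "u \<in> cell_of ` {..<n}"
  then obtain j where j: "j < n" "u = cell_of j" by auto
  then have "word_path ! pos j = North" "pos j < 2 * n"
    using nth_word_path[of "pos j"] pos_bound[of j] by auto
  then show "u \<in> north_cells word_path"
    using j point_pos[of j] by (force simp: north_cells_def)
qed

lemma dyck_word_path: "dyck_path n word_path"
  unfolding dyck_path_def
proof (intro conjI allI impI)
  have "norths (2 * n) = n"
    using pos_bound by (intro norths_eqI) (auto dest: Suc_lessD)
  then show "point word_path (length word_path) = (int n, int n)"
    using point_word_path[of "2 * n"] by simp
next
  fix k assume k: "k \<le> length word_path"
  \<comment> \<open>If \<open>k\<close> exceeded \<open>2 * ?j\<close>, then the North step of row
    \<open>?j\<close>, at index \<open>col ?j + ?j \<le> 2 * ?j\<close>, would also come before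
    \<open>k\<close>, giving \<open>?j + 1\<close> North steps where only \<open>?j\<close> are
    counted.\<close>
  have "k \<le> 2 * norths k"
  proof (rule ccontr)
    let ?j = "norths k"
    assume less: "\<not> k \<le> 2 * ?j"
    then have jn: "?j < n" using k by simp
    then have "pos i < k" if "i \<le> ?j" for i
      using that less pos_less[of i ?j] col_le[of ?j] by (cases "i = ?j") (auto simp: pos_def)
    then have "{..?j} \<subseteq> {j \<in> {..<n}. pos j < k}" using jn by auto
    then have "card {..?j} \<le> ?j" unfolding norths_def by (intro card_mono) auto
    then show False by simp
  qed
  then show "fst (point word_path k) \<le> snd (point word_path k)"
    using k by (simp add: point_word_path)
qed

section \<open>The cars\<close>

lemma word_car_Some: "word_car u = Some r \<longleftrightarrow> (\<exists>j<n. u = cell_of j \<and> r = l j)"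
  by (auto simp: word_car_def)

text \<open>Since \<open>col\<close> is monotone, the rows of one column are consecutive. Between
  neighbours in a column the diagonal grows by exactly one, so \<open>l_Suc\<close> applies at each
  step.\<close>

lemma column_increasing:
  "i < j \<Longrightarrow> j < n \<Longrightarrow> col i = col j \<Longrightarrow> l i < l j"
proof (induction j rule: less_induct)
  case (less j)
  then obtain k where k: "j = Suc k" by (cases j) auto
  have "col i \<le> col k" "col k \<le> col j"
    using less.prems k col_mono[of i k] col_mono[of k j] by auto
  then have c: "col k = col j" "col i = col k" using less.prems by auto
  then have "d j = Suc (d k)"
    using int_col[of k] int_col[of j] less.prems k by simp
  then have "l k < l j" using l_Suc[of k] less.prems k by simp
  moreover have "l i \<le> l k"
    using less.IH[of k] less.prems k c by (cases "i = k") auto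
  ultimately show ?case by simp
qed

lemma parking_word: "parking_function n word_path word_car"
  unfolding parking_function_def
proof (intro conjI)
  show "dom word_car = north_cells word_path"
    by (auto simp: north_cells_word_path word_car_Some dom_def)
  show "inj_on word_car (dom word_car)"
  proof (rule inj_onI)
    fix u v assume "u \<in> dom word_car" and eq: "word_car u = word_car v"
    then obtain r where "word_car u = Some r" by blast
    with eq obtain i j where "i < n" "j < n" "l i = l j" "u = cell_of i" "v = cell_of j"
      by (metis word_car_Some)
    then show "u = v" using l_inj by (auto dest: inj_onD)
  qed
  show "\<forall>r\<in>ran word_car. 0 < r"
    using l_pos by (auto simp: ran_def word_car_Some)
  show "\<forall>i j j' r r'. word_car (i, j) = Some r \<longrightarrow> word_car (i, j') = Some r' \<longrightarrow> j < j' \<longrightarrow> r < r'"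
    using column_increasing by (auto simp: word_car_Some)
qed (rule dyck_word_path)

section \<open>Marked valleys\<close>

lemma mark_pos:
  assumes "j \<in> m"
  shows "Suc (pos j - 1) = pos j" and "valley word_path word_car (pos j - 1)"
proof -
  obtain i where i: "j = Suc i" "j < n" using assms m_sub by (cases j) auto
  have d: "d j \<le> d i" and v: "d j = d i \<Longrightarrow> l i < l j"
    using m_valley[of i] assms i by auto
  have c: "int (col i) = int i - int (d i)" "int (col j) = int i + 1 - int (d j)"
    using int_col[of i] int_col[of j] i by auto
  \<comment> \<open>From \<open>d j \<le> d i\<close> the column moves right by at least one, so an
    East step separates the North steps of rows \<open>i\<close> and \<open>j\<close>. This also
    makes the truncated subtraction in \<open>pos j - 1\<close> harmless.\<close>
  have gap: "pos i < pos j - 1" using c d i by (simp add: pos_def)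
  show S: "Suc (pos j - 1) = pos j" using gap by simp
  have below: "pos k < pos j - 1" if "k < j" for k
    using that gap pos_less[of k i] i by (cases "k = i") auto
  have above: "pos j \<le> pos k" if "j \<le> k" "k < n" for k
    using that pos_less[of j k] by (cases "k = j") auto
  have north: "norths (pos j - 1) = j"
    using i below above by (intro norths_eqI) force+
  have "pos j - 1 < 2 * n" using pos_bound[of j] i by simp
  then have pt: "point word_path (pos j - 1) = (int (col j) - 1, int j)"
    using north gap point_word_path[of "pos j - 1"] by (simp add: pos_def)
  have notin: "pos j - 1 \<notin> pos ` {..<n}"
    using below above S by (metis imageE lessThan_iff less_irrefl not_less Suc_n_not_le_n)
  \<comment> \<open>The only car that can sit in this cell is that of row \<open>i = j - 1\<close>.
    Its column is then \<open>col j - 1\<close>, which means \<open>d j = d i\<close>, and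
    \<open>v\<close> compares the labels.\<close>
  have "word_car (int (col j) - 1, int j - 1) = None \<or>
      the (word_car (int (col j) - 1, int j - 1)) < the (word_car (cell_of j))"
  proof (cases "word_car (int (col j) - 1, int j - 1)")
    case (Some r)
    then have "int (col i) = int (col j) - 1" "r = l i"
      using i by (auto simp: word_car_Some)
    moreover from this have "r < l j" using c v by simp
    moreover have "word_car (cell_of j) = Some (l j)"
      using i by (auto simp: word_car_Some)
    ultimately show ?thesis using Some by simp
  qed simp
  then show "valley word_path word_car (pos j - 1)"
    unfolding valley_def S pt using i pos_bound[of j] notin point_pos[of j] \<open>pos j - 1 < 2 * n\<close>
    by (auto simp: nth_word_path)
qed

lemma inj_mark_pos: "inj_on (\<lambda>j. pos j - 1) m"
proof (rule inj_onI)
  fix i j assume a: "i \<in> m" "j \<in> m" "pos i - 1 = pos j - 1"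
  then have "pos i = pos j" using mark_pos(1) by metis
  moreover have "i < n" "j < n" using a m_sub by auto
  ultimately show "i = j" using pos_inj by (auto dest: inj_onD)
qed

lemma card_word_marks: "card word_marks = card m"
  unfolding word_marks_def by (rule card_image[OF inj_mark_pos])

lemma marked_word_cells: "marked_cells word_path word_marks = cell_of ` m"
proof -
  have "point word_path (Suc (pos j - 1)) = cell_of j" if "j \<in> m" for j
    using that mark_pos(1)[of j] point_pos[of j] m_sub by auto
  then show ?thesis unfolding marked_cells_def word_marks_def image_image by simp
qed

lemma vmpf_word: "valley_marked_parking_function n word_path word_car word_marks"
  using parking_word mark_pos(2)
  by (auto simp: valley_marked_parking_function_def word_marks_def)

section \<open>Area and dinv in terms of the area word\<close>

lemma area_word_path: "area word_path = (\<Sum>j<n. d j)"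
proof -
  \<comment> \<open>The full cells of row \<open>j\<close> lie in the columns from
    \<open>col j\<close> to \<open>j - 1\<close>, so there are \<open>d j\<close> of them.\<close>
  have "{(i, j). i + 1 \<le> j \<and> (\<exists>x\<le>i. (x, j) \<in> north_cells word_path)} =
      (\<lambda>(j, i). (int i, int j)) ` (SIGMA j:{..<n}. {col j..<j})"
  proof (intro equalityI subsetI)
    fix u :: "int \<times> int"
    assume "u \<in> {(i, j). i + 1 \<le> j \<and> (\<exists>x\<le>i. (x, j) \<in> north_cells word_path)}"
    then obtain i k where "u = (i, int k)" "i + 1 \<le> int k" "int (col k) \<le> i" "k < n"
      by (auto simp: north_cells_word_path)
    then show "u \<in> (\<lambda>(j, i). (int i, int j)) ` (SIGMA j:{..<n}. {col j..<j})"
      by (intro image_eqI[of _ _ "(k, nat i)"]) auto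
  next
    fix u assume "u \<in> (\<lambda>(j, i). (int i, int j)) ` (SIGMA j:{..<n}. {col j..<j})"
    then obtain i k where "u = (int i, int k)" "k < n" "col k \<le> i" "i < k" by auto
    moreover from this have "cell_of k \<in> north_cells word_path" "int (col k) \<le> int i"
      by (auto simp: north_cells_word_path)
    ultimately show "u \<in> {(i, j). i + 1 \<le> j \<and> (\<exists>x\<le>i. (x, j) \<in> north_cells word_path)}"
      by (auto intro!: exI[of _ "int (col k)"])
  qed
  moreover have "inj_on (\<lambda>(j, i). (int i, int j)) (SIGMA j:{..<n}. {col j..<j})"
    by (auto simp: inj_on_def)
  ultimately have "area word_path = card (SIGMA j:{..<n}. {col j..<j})"
    unfolding area_def by (simp add: card_image)
  also have "\<dots> = (\<Sum>j<n. d j)"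
    by (simp add: d_le col_def)
  finally show ?thesis .
qed

text \<open>For the pairs in question, left of and below are the same: \<open>col\<close> is
  monotone, so a smaller column forces a lower row, and conversely a lower row whose diagonal is
  equal or one higher has a strictly smaller column.\<close>

lemma dinv_word: "dinv word_path word_car word_marks = word_dinv n d l m"
proof -
  let ?R = "SIGMA i:{..<n} - m. {i<..<n}"
  let ?P = "{(i, j) \<in> ?R. d i = d j \<and> l i < l j}"
  let ?S = "{(i, j) \<in> ?R. d i = Suc (d j) \<and> l j < l i}"
  let ?I = "SIGMA i:{..<n} - m. {j \<in> {i<..<n}. word_inv d l i j}"
  have marked: "cell_of i \<in> marked_cells word_path word_marks \<longleftrightarrow> i \<in> m" for i
    by (auto simp: marked_word_cells)
  have diag: "diagonal (cell_of i) = int (d i)" if "i < n" for i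
    using that by (simp add: diagonal_def int_col)
  have fin: "finite ?R" by simp
  have "primary_inversions word_path word_car word_marks = (\<lambda>(i, j). (cell_of i, cell_of j)) ` ?P"
  proof (intro equalityI subsetI)
    fix w assume "w \<in> primary_inversions word_path word_car word_marks"
    then obtain i j where w: "w = (cell_of i, cell_of j)" "i < n" "j < n" "l i < l j"
      "diagonal (cell_of i) = diagonal (cell_of j)" "col i < col j" "i \<notin> m"
      by (fastforce simp: primary_inversions_def word_car_Some marked)
    moreover have "i < j" using w col_mono[of j i] by (metis not_le)
    ultimately have "(i, j) \<in> ?P" by (simp add: diag)
    then show "w \<in> (\<lambda>(i, j). (cell_of i, cell_of j)) ` ?P" using w by force
  next
    fix w assume "w \<in> (\<lambda>(i, j). (cell_of i, cell_of j)) ` ?P"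
    then obtain i j where w: "w = (cell_of i, cell_of j)" "i < j" "j < n" "l i < l j"
      "d i = d j" "i \<notin> m" by auto
    moreover have "int (col i) < int (col j)" using w by (simp add: int_col)
    ultimately show "w \<in> primary_inversions word_path word_car word_marks"
      by (auto simp: primary_inversions_def word_car_Some marked diag)
  qed
  then have P: "card (primary_inversions word_path word_car word_marks) = card ?P"
    by (simp add: card_image inj_on_def)
  have "secondary_inversions word_path word_car word_marks = (\<lambda>(i, j). (cell_of j, cell_of i)) ` ?S"
  proof (intro equalityI subsetI)
    fix w assume "w \<in> secondary_inversions word_path word_car word_marks"
    then obtain i j where w: "w = (cell_of j, cell_of i)" "i < n" "j < n" "l j < l i"
      "diagonal (cell_of i) = diagonal (cell_of j) + 1" "col i < col j" "i \<notin> m"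
      by (fastforce simp: secondary_inversions_def word_car_Some marked)
    moreover have "i < j" using w col_mono[of j i] by (metis not_le)
    ultimately have "(i, j) \<in> ?S" by (simp add: diag)
    then show "w \<in> (\<lambda>(i, j). (cell_of j, cell_of i)) ` ?S" using w by force
  next
    fix w assume "w \<in> (\<lambda>(i, j). (cell_of j, cell_of i)) ` ?S"
    then obtain i j where w: "w = (cell_of j, cell_of i)" "i < j" "j < n" "l j < l i"
      "d i = Suc (d j)" "i \<notin> m" by auto
    moreover have "int (col i) < int (col j)" using w by (simp add: int_col)
    ultimately show "w \<in> secondary_inversions word_path word_car word_marks"
      by (auto simp: secondary_inversions_def word_car_Some marked diag)
  qed
  then have S: "card (secondary_inversions word_path word_car word_marks) = card ?S"
    by (simp add: card_image inj_on_def)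
  have "card ?P + card ?S = card (?P \<union> ?S)"
    by (rule card_Un_disjoint[symmetric]) (auto intro: finite_subset[OF _ fin])
  also have "?P \<union> ?S = ?I"
    by (auto simp: word_inv_def)
  also have "card ?I = (\<Sum>i\<in>{..<n} - m. card {j \<in> {i<..<n}. word_inv d l i j})"
    by simp
  finally have "card ?P + card ?S = \<dots>" .
  moreover have "word_dinv n d l m =
      (\<Sum>i\<in>{..<n} - m. int (card {j \<in> {i<..<n}. word_inv d l i j})) - int (card m)"
  proof -
    have "m \<subseteq> {..<n}" using m_sub by auto
    then show ?thesis
      unfolding word_dinv_def by (subst sum.subset_diff[of m]) (auto simp: sum_negf)
  qed
  ultimately show ?thesis
    unfolding dinv_def P S card_word_marks of_nat_add[symmetric] of_nat_sum[symmetric] by simp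
qed

end

section \<open>Prepending a row\<close>

text \<open>Common to both ways of prepending: the new bottom row is unmarked and is the lower row
  of no inversion, while all other rows keep their inversions after an index shift.\<close>

lemma word_dinv_Suc:
  assumes inv: "\<And>i j. word_inv d' l' (Suc i) (Suc j) = word_inv d l i j"
    and "0 \<notin> m'" and m': "\<And>i. Suc i \<in> m' \<longleftrightarrow> i \<in> m"
    and first: "\<And>j. 0 < j \<Longrightarrow> j \<le> n \<Longrightarrow> \<not> word_inv d' l' 0 j"
  shows "word_dinv (Suc n) d' l' m' = word_dinv n d l m"
proof -
  have "{j \<in> {Suc i<..<Suc n}. word_inv d' l' (Suc i) j} =
      Suc ` {j \<in> {i<..<n}. word_inv d l i j}" for i
    by (auto simp: inv image_iff Suc_less_eq2)
  then have "card {j \<in> {Suc i<..<Suc n}. word_inv d' l' (Suc i) j} =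
      card {j \<in> {i<..<n}. word_inv d l i j}" for i
    by (simp add: card_image)
  moreover have "{j \<in> {0<..<Suc n}. word_inv d' l' 0 j} = {}"
    using first by auto
  ultimately show ?thesis
    using assms(2) unfolding word_dinv_def sum.lessThan_Suc_shift m'
    by (simp del: mem_Collect_eq greaterThanLessThan_iff cong: if_cong)
qed

text \<open>The new row is lowest, so it could only be the smaller car of a primary inversion, which
  its label excludes, or lie one diagonal above another row, which diagonal 0 excludes.\<close>

lemma prepend_largest:
  assumes "labelled_area_word n d l m"
  obtains d' l' m' where "labelled_area_word (Suc n) d' l' m'"
    "(\<Sum>i<Suc n. d' i) = (\<Sum>i<n. d i)" "word_dinv (Suc n) d' l' m' = word_dinv n d l m"
    "card m' = card m"
proof -
  interpret labelled_area_word n d l m by fact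
  define d' where "d' = case_nat 0 d"
  \<comment> \<open>One more than the sum of all labels serves as a label above each of
    them.\<close>
  define l' where "l' = case_nat (Suc (\<Sum>i<n. l i)) l"
  have large: "l i < l' 0" if "i < n" for i
    using that member_le_sum[of i "{..<n}" l] by (simp add: l'_def)
  have [simp]: "d' 0 = 0" "d' (Suc i) = d i" "l' (Suc i) = l i" for i
    by (simp_all add: d'_def l'_def)
  have "labelled_area_word (Suc n) d' l' (Suc ` m)"
  proof
    show "d' (Suc i) \<le> Suc (d' i)" if "Suc i < Suc n" for i
      using that d_0 d_Suc by (cases i) auto
    show "inj_on l' {..<Suc n}"
      using l_inj large by (fastforce simp: inj_on_def less_Suc_eq_0_disj)
    show "0 < l' i" if "i < Suc n" for i
      using that l_pos by (cases i) (auto simp: l'_def)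
    show "l' i < l' (Suc i)" if "Suc i < Suc n" "d' (Suc i) = Suc (d' i)" for i
      using that d_0 l_Suc by (cases i) auto
    show "Suc ` m \<subseteq> {1..<Suc n}" using m_sub by auto
    show "d' (Suc i) < d' i \<or> d' (Suc i) = d' i \<and> l' i < l' (Suc i)" if "Suc i \<in> Suc ` m" for i
      using that m_sub m_valley by (cases i) auto
  qed simp
  moreover have "(\<Sum>i<Suc n. d' i) = (\<Sum>i<n. d i)"
    unfolding sum.lessThan_Suc_shift by simp
  moreover have "word_dinv (Suc n) d' l' (Suc ` m) = word_dinv n d l m"
  proof (rule word_dinv_Suc)
    show "\<not> word_inv d' l' 0 j" if "0 < j" "j \<le> n" for j
      using that large[of "j - 1"] by (cases j) (auto simp: word_inv_def)
  qed (auto simp: word_inv_def)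
  moreover have "card (Suc ` m) = card m" by (simp add: card_image)
  ultimately show ?thesis using that by blast
qed

text \<open>The new row is alone in diagonal 0 and below all others, so it is the lower row of no
  inversion. Raising the old labels by one frees the label 1 and makes it smaller than the car
  directly above it.\<close>

lemma prepend_below:
  assumes "labelled_area_word n d l m"
  obtains d' l' m' where "labelled_area_word (Suc n) d' l' m'"
    "(\<Sum>i<Suc n. d' i) = n + (\<Sum>i<n. d i)" "word_dinv (Suc n) d' l' m' = word_dinv n d l m"
    "card m' = card m"
proof -
  interpret labelled_area_word n d l m by fact
  define d' where "d' = case_nat 0 (Suc \<circ> d)"
  define l' where "l' = case_nat 1 (Suc \<circ> l)"
  have [simp]: "d' 0 = 0" "d' (Suc i) = Suc (d i)" "l' 0 = 1" "l' (Suc i) = Suc (l i)" for i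
    by (simp_all add: d'_def l'_def)
  have "labelled_area_word (Suc n) d' l' (Suc ` m)"
  proof
    show "d' (Suc i) \<le> Suc (d' i)" if "Suc i < Suc n" for i
      using that d_0 d_Suc by (cases i) auto
    show "inj_on l' {..<Suc n}"
      using l_inj l_pos by (fastforce simp: inj_on_def less_Suc_eq_0_disj)
    show "0 < l' i" if "i < Suc n" for i
      by (cases i) auto
    show "l' i < l' (Suc i)" if "Suc i < Suc n" "d' (Suc i) = Suc (d' i)" for i
      using that l_pos l_Suc by (cases i) auto
    show "Suc ` m \<subseteq> {1..<Suc n}" using m_sub by auto
    show "d' (Suc i) < d' i \<or> d' (Suc i) = d' i \<and> l' i < l' (Suc i)" if "Suc i \<in> Suc ` m" for i
      using that m_sub m_valley by (cases i) auto
  qed simp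
  moreover have "(\<Sum>i<Suc n. d' i) = n + (\<Sum>i<n. d i)"
    unfolding sum.lessThan_Suc_shift by (simp add: sum_Suc)
  moreover have "word_dinv (Suc n) d' l' (Suc ` m) = word_dinv n d l m"
  proof (rule word_dinv_Suc)
    show "\<not> word_inv d' l' 0 j" if "0 < j" "j \<le> n" for j
      using that by (cases j) (auto simp: word_inv_def)
  qed (auto simp: word_inv_def)
  moreover have "card (Suc ` m) = card m" by (simp add: card_image)
  ultimately show ?thesis using that by blast
qed

section \<open>Nearly maximal dinv\<close>

text \<open>This is the dinv when the top \<open>c\<close> rows are marked and every other row forms
  an inversion with all rows above it; the marked rows lose \<open>c choose 2\<close> pairs and
  \<open>c\<close> for their marks.\<close>

lemma sum_top_marked:
  "c \<le> n \<Longrightarrow> (\<Sum>i<n. if n - c \<le> i then -1 else int (n - 1 - i)) =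
     int (n choose 2) - int (Suc c choose 2)"
proof (induction n)
  case (Suc n)
  show ?case
  proof (cases "c = Suc n")
    case True
    then show ?thesis by (simp add: numeral_2_eq_2)
  next
    case False
    then have "c \<le> n" using Suc.prems by simp
    then have "(Suc n - c \<le> Suc i) = (n - c \<le> i)" "Suc n - 1 - Suc i = n - 1 - i" for i by auto
    then show ?thesis
      using Suc.IH[OF \<open>c \<le> n\<close>] \<open>c \<le> n\<close> unfolding sum.lessThan_Suc_shift
      by (simp add: numeral_2_eq_2 cong: if_cong)
  qed
qed (simp add: numeral_2_eq_2)

text \<open>Row \<open>0\<close> loses \<open>e\<close> of its inversions with the \<open>n - 1 - a\<close> upper rows of diagonal \<open>0\<close>, and
  row \<open>1\<close> loses \<open>f\<close> of its inversions with the \<open>a - 1\<close> other rows of diagonal \<open>1\<close>.\<close>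

lemma nearly_maximal_word:
  fixes n a c e f :: nat
  assumes a: "a + 2 \<le> n" and e: "e \<le> n - 1 - a" and f: "f \<le> a - 1"
    and c: "c < n" "0 < a \<Longrightarrow> c + 2 \<le> n" "c + 1 = n \<Longrightarrow> e = 0" "c + 2 = n \<Longrightarrow> f = 0"
  obtains d l m where "labelled_area_word n d l m" "(\<Sum>i<n. d i) = a" "card m = c"
    "word_dinv n d l m = int (n choose 2) - int (Suc c choose 2) - int a - int e - int f"
proof -
  define d :: "nat \<Rightarrow> nat" where "d i = (if 1 \<le> i \<and> i \<le> a then 1 else 0)" for i
  \<comment> \<open>Even labels increase upward within each diagonal, with all of diagonal 1 above
    the upper rows of diagonal 0. The adjusted bottom rows get odd labels: \<open>2 * e + 1\<close>
    exceeds exactly \<open>e\<close> of the labels \<open>2, 4, ...\<close> in diagonal 0, and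
    \<open>2 * n + 2 * f + 3\<close> exceeds exactly \<open>f\<close> of those of the other rows in
    diagonal 1.\<close>
  define l where "l i = (if i = 0 then 2 * e + 1
    else if i = 1 \<and> 1 \<le> a then 2 * n + 2 * f + 3
    else if i \<le> a then 2 * n + 2 * i else 2 * (i - a))" for i
  define m where "m = {n - c..<n}"
  have "labelled_area_word n d l m"
  proof
    show "inj_on l {..<n}"
    proof (rule linorder_inj_onI)
      fix i j assume "i < j" "i \<in> {..<n}" "j \<in> {..<n}"
      moreover have "2 * e + 1 \<noteq> 2 * k" "2 * e + 1 \<noteq> 2 * n + 2 * k"
        "2 * e \<noteq> Suc (Suc (2 * n + 2 * k))"
        "2 * f + 3 \<noteq> 2 * k" "2 * n + 2 * f + 3 \<noteq> 2 * k" for k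
        using e by presburger+
      moreover have "2 * n + 2 * k \<noteq> 2 * (k' - a)" if "k' < n" for k k' using that by linarith
      ultimately show "l i \<noteq> l j" unfolding l_def by auto
    qed auto
    \<comment> \<open>The side conditions on \<open>c\<close> enter here. Row 1 is markable only if
      \<open>a = 0\<close> and \<open>e = 0\<close>; if row 2 is marked and lies in diagonal 1, its
      label must exceed that of row 1, which forces \<open>f = 0\<close>.\<close>
    show "d (Suc i) < d i \<or> d (Suc i) = d i \<and> l i < l (Suc i)" if "Suc i \<in> m" for i
    proof -
      have i: "Suc i < n" "n \<le> Suc i + c" using that c by (auto simp: m_def)
      consider "i = 0" | "i = 1" | "i \<ge> 2" by linarith
      then show ?thesis using i a c e f by cases (auto simp: d_def l_def)
    qed
  qed (use a c e in \<open>auto simp: d_def l_def m_def\<close>)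
  moreover have "(\<Sum>i<n. d i) = a"
  proof -
    have "(\<Sum>i<n. d i) = card ({..<n} \<inter> {i. 1 \<le> i \<and> i \<le> a})"
      unfolding d_def by (simp add: sum.If_cases)
    also have "{..<n} \<inter> {i. 1 \<le> i \<and> i \<le> a} = {1..a}" using a by auto
    finally show ?thesis by simp
  qed
  moreover have "card m = c" using c by (simp add: m_def)
  moreover have "word_dinv n d l m =
      int (n choose 2) - int (Suc c choose 2) - int a - int e - int f"
  proof -
    \<comment> \<open>Besides its \<open>e\<close> lost inversions, row 0 has none with the
      \<open>a\<close> rows of diagonal 1, because the lower row of a secondary inversion is in the
      higher diagonal.\<close>
    let ?loss = "\<lambda>i. if i = 0 then int a + int e else if i = 1 then int f else 0"
    have row: "(if i \<in> m then -1 else int (card {j \<in> {i<..<n}. word_inv d l i j})) =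
        (if n - c \<le> i then -1 else int (n - 1 - i)) - ?loss i" if "i < n" for i
    proof -
      consider "i = 0" | "i = 1" "0 < a" | "i = 1" "a = 0" | "i \<ge> 2" by linarith
      then show ?thesis
      proof cases
        case 1
        have "{j \<in> {0<..<n}. word_inv d l 0 j} = {a + e<..<n}"
          by (auto simp: word_inv_def d_def l_def)
        then show ?thesis using 1 a c e by (simp add: m_def)
      next
        case 2
        have "{j \<in> {1<..<n}. word_inv d l 1 j} = {Suc f<..<n}"
          using 2 a f by (auto simp: word_inv_def d_def l_def)
        then show ?thesis using 2 a c e f by (auto simp: m_def)
      next
        case 3
        have "{j \<in> {1<..<n}. word_inv d l 1 j} = {1<..<n}"
          using 3 by (auto simp: word_inv_def d_def l_def)
        then show ?thesis using 3 f that by (auto simp: m_def)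
      next
        case 4
        have "{j \<in> {i<..<n}. word_inv d l i j} = {i<..<n}"
          using 4 by (auto simp: word_inv_def d_def l_def)
        then show ?thesis using 4 that by (auto simp: m_def)
      qed
    qed
    have "(\<Sum>i<n. ?loss i) = int a + int e + int f"
    proof -
      obtain k where k: "n = Suc (Suc k)" using a by (metis add_2_eq_Suc' le_Suc_ex add_Suc)
      show ?thesis unfolding k sum.lessThan_Suc_shift by simp
    qed
    then show ?thesis
      unfolding word_dinv_def using sum_top_marked[of c n] c
      by (simp add: row sum_subtractf)
  qed
  ultimately show ?thesis using that by blast
qed

section \<open>Induction on the size\<close>

lemma labelled_area_word_exists:
  assumes "1 \<le> n" "a + b + (Suc c choose 2) \<le> n choose 2"
  shows "\<exists>d l m. labelled_area_word n d l m \<and> (\<Sum>i<n. d i) = a \<and>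
    word_dinv n d l m = int b \<and> card m = c"
  using assms
\<comment> \<open>Only the area changes when a bottom row is split off; \<open>b\<close> and
  \<open>c\<close> stay fixed.\<close>
proof (induction n arbitrary: a rule: dec_induct)
  case base
  then have "a = 0" "b = 0" "c = 0" by (auto simp: numeral_2_eq_2)
  moreover have "labelled_area_word 1 (\<lambda>_. 0) (\<lambda>_. 1) {}"
    by unfold_locales (auto simp: inj_on_def)
  moreover have "word_dinv 1 (\<lambda>_. 0) (\<lambda>_. 1) {} = 0"
    by (auto simp: word_dinv_def word_inv_def)
  ultimately show ?case by (intro exI[of _ "\<lambda>_. 0"] exI[of _ "\<lambda>_. 1"] exI[of _ "{}"]) auto
next
  case (step n)
  have ch: "Suc n choose 2 = n + (n choose 2)" for n by (simp add: numeral_2_eq_2)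
  show ?case
  proof (cases "n \<le> a")
    case True
    then have "a - n + b + (Suc c choose 2) \<le> n choose 2"
      using step.prems ch[of n] by linarith
    then obtain d l m where "labelled_area_word n d l m" "(\<Sum>i<n. d i) = a - n"
      "word_dinv n d l m = int b" "card m = c" using step.IH by blast
    with True show ?thesis by (metis prepend_below le_add_diff_inverse)
  next
    case a: False
    show ?thesis
    proof (cases "a + b + (Suc c choose 2) \<le> n choose 2")
      case True
      then obtain d l m where "labelled_area_word n d l m" "(\<Sum>i<n. d i) = a"
        "word_dinv n d l m = int b" "card m = c" using step.IH by blast
      then show ?thesis by (metis prepend_largest)
    next
      case False
      \<comment> \<open>\<open>D\<close> is the deficit of \<open>b\<close> from the maximal dinv
        for \<open>a\<close> and \<open>c\<close>. It is below \<open>n\<close> because the bound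
        fails for \<open>n\<close>, and \<open>Suc n choose 2\<close> exceeds
        \<open>n choose 2\<close> by just \<open>n\<close>.\<close>
      define D where "D = (Suc n choose 2) - (a + b + (Suc c choose 2))"
      have D: "a + b + (Suc c choose 2) + D = Suc n choose 2" "D < n"
        using False step.prems ch[of n] by (auto simp: D_def)
      \<comment> \<open>Row 0 absorbs as much of the deficit as its \<open>n - a\<close> upper
        neighbours in diagonal 0 allow, and row 1 takes the rest, which is at most
        \<open>a - 1\<close>.\<close>
      define e where "e = min D (n - a)"
      define f where "f = D - e"
      have mono: "x choose 2 \<le> y choose 2" if "x \<le> y" for x y :: nat
        using that by (rule binomial_right_mono)
      have "c \<le> n"
      proof (rule ccontr)
        assume "\<not> c \<le> n"
        then have "Suc (Suc n) choose 2 \<le> Suc c choose 2" by (intro mono) simp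
        then show False using D ch[of "Suc n"] by simp
      qed
      \<comment> \<open>With nearly all rows marked, the term \<open>Suc c choose 2\<close> uses up
        most of \<open>Suc n choose 2\<close>. The room left for \<open>a + D\<close> is none if
        \<open>c = n\<close> and at most \<open>n\<close> if \<open>c + 1 = n\<close>, which yields
        the side conditions on \<open>e\<close> and \<open>f\<close>.\<close>
      moreover have "a = 0 \<and> D = 0" if "c = n" using that D by simp
      moreover have "a + D \<le> n" if "c + 1 = n" using that D ch[of n] by simp
      moreover have ef: "e + f = D" by (simp add: e_def f_def)
      moreover have "e \<le> Suc n - 1 - a" "f \<le> a - 1" "a + D \<le> n \<Longrightarrow> f = 0"
        using a D(2) by (auto simp: e_def f_def)
      moreover have "a + 2 \<le> Suc n" using a by simp
      moreover have "0 < a \<Longrightarrow> c + 2 \<le> Suc n" using calculation by linarith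
      ultimately obtain d l m where "labelled_area_word (Suc n) d l m"
        "(\<Sum>i<Suc n. d i) = a" "card m = c" and dinv: "word_dinv (Suc n) d l m =
          int (Suc n choose 2) - int (Suc c choose 2) - int a - int e - int f"
        using nearly_maximal_word[of a "Suc n" e f c] by auto
      moreover have "word_dinv (Suc n) d l m = int b"
        unfolding dinv D(1)[symmetric] ef[symmetric] by simp
      ultimately show ?thesis by blast
    qed
  qed
qed

theorem theorem4p8:
  fixes n a b c :: nat
  assumes "1 \<le> n"
    and "a + b + ((c + 1) choose 2) \<le> n choose 2"
  shows "\<exists>p car M. valley_marked_parking_function n p car M \<and>
           area p = a \<and> dinv p car M = int b \<and> card M = c"
proof -
  obtain d l m where w: "labelled_area_word n d l m" and "(\<Sum>i<n. d i) = a"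
    "word_dinv n d l m = int b" "card m = c"
    using labelled_area_word_exists[of n a b c] assms by auto
  then show ?thesis
    using labelled_area_word.vmpf_word[OF w] labelled_area_word.area_word_path[OF w]
      labelled_area_word.dinv_word[OF w] labelled_area_word.card_word_marks[OF w]
    by metis
qed

end
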